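(* Let $G$ be a Roelcke-precompact Polish group and let $\varphi\colon G \to B$ be its Bohr compactification. Then $\varphi$ is surjective.
   Context: A topological group $G$ is Roelcke-precompact if for every open neighbourhood $U$ of the identity there is a finite set $F \subseteq G$ with $UFU = G$. The Bohr compactification of a topological group $G$ is a continuous homomorphism $\varphi\colon G \to B$ into a compact (Hausdorff) group $B$ which is universal: every continuous homomorphism from $G$ into a compact group factors uniquely through $\varphi$. *)

theory Defs
  imports "HOL-Analysis.Analysis" "HOL-Algebra.Group"
begin

definition topological_group :: "('a, 'm) monoid_scheme \<Rightarrow> 'a topology \<Rightarrow> bool" where
  "topological_group G T \<longleftrightarrow>
     group G \<and> topspace T = carrier G \<and>
     continuous_map (prod_topology T T) T (\<lambda>p. fst p \<otimes>\<^bsub>G\<^esub> snd p) \<and>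
     continuous_map T T (\<lambda>x. inv\<^bsub>G\<^esub> x)"

definition Polish_space :: "'a topology \<Rightarrow> bool" where
  "Polish_space T \<longleftrightarrow> separable_space T \<and> completely_metrizable_space T"

definition Polish_group :: "('a, 'm) monoid_scheme \<Rightarrow> 'a topology \<Rightarrow> bool" where
  "Polish_group G T \<longleftrightarrow> topological_group G T \<and> Polish_space T"

definition set_prod3 :: "('a, 'm) monoid_scheme \<Rightarrow> 'a set \<Rightarrow> 'a set \<Rightarrow> 'a set \<Rightarrow> 'a set" where
  "set_prod3 G U F V = {u \<otimes>\<^bsub>G\<^esub> f \<otimes>\<^bsub>G\<^esub> v | u f v. u \<in> U \<and> f \<in> F \<and> v \<in> V}"

definition Roelcke_precompact :: "('a, 'm) monoid_scheme \<Rightarrow> 'a topology \<Rightarrow> bool" where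
  "Roelcke_precompact G T \<longleftrightarrow>
     (\<forall>U. openin T U \<and> \<one>\<^bsub>G\<^esub> \<in> U \<longrightarrow>
        (\<exists>F. finite F \<and> F \<subseteq> carrier G \<and> set_prod3 G U F U = carrier G))"

definition compact_group :: "('a, 'm) monoid_scheme \<Rightarrow> 'a topology \<Rightarrow> bool" where
  "compact_group K T \<longleftrightarrow> topological_group K T \<and> compact_space T \<and> Hausdorff_space T"

definition cont_hom ::
  "('a, 'm) monoid_scheme \<Rightarrow> 'a topology \<Rightarrow> ('b, 'n) monoid_scheme \<Rightarrow> 'b topology \<Rightarrow> ('a \<Rightarrow> 'b) \<Rightarrow> bool" where
  "cont_hom G T H S f \<longleftrightarrow> f \<in> hom G H \<and> continuous_map T S f"

definition Bohr_compactification_wrt ::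
  "('a, 'm) monoid_scheme \<Rightarrow> 'a topology \<Rightarrow> ('a \<Rightarrow> 'b) \<Rightarrow> ('b, 'n) monoid_scheme \<Rightarrow> 'b topology
   \<Rightarrow> 'c itself \<Rightarrow> bool" where
  "Bohr_compactification_wrt G T \<phi> B S (_ :: 'c itself) \<longleftrightarrow>
     compact_group B S \<and> cont_hom G T B S \<phi> \<and>
     (\<forall>(K :: 'c monoid) R \<psi>. compact_group K R \<and> cont_hom G T K R \<psi> \<longrightarrow>
        (\<exists>h. cont_hom B S K R h \<and> (\<forall>g\<in>carrier G. \<psi> g = h (\<phi> g))) \<and>
        (\<forall>h1 h2. cont_hom B S K R h1 \<and> (\<forall>g\<in>carrier G. \<psi> g = h1 (\<phi> g)) \<and>
                 cont_hom B S K R h2 \<and> (\<forall>g\<in>carrier G. \<psi> g = h2 (\<phi> g))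
                 \<longrightarrow> (\<forall>x\<in>carrier B. h1 x = h2 x)))"

end

theory Submission
  imports Defs
begin

text \<open>
  The universal property forces the image of \<open>\<phi>\<close> to be dense. For a neighbourhood \<open>V\<close> of the
  identity of \<open>G\<close> choose \<open>U\<close> with \<open>U U\<^sup>-\<^sup>1 U\<^sup>-\<^sup>1 U \<subseteq> V\<close> and let \<open>C\<close> be the closure of \<open>\<phi>(U)\<close>. Roelcke
  precompactness makes \<open>B\<close> a finite union of closed sets \<open>C f C\<close>; those that contain the identity lie
  in the closure of \<open>\<phi>(V)\<close>, and the others miss a neighbourhood of the identity. Hence the closure
  of \<open>\<phi>(V)\<close> is a neighbourhood of the identity, i.e. \<open>\<phi>\<close> is nearly open. Finally, a
  Banach--Mazur argument with two interleaved sequences of shrinking balls in \<open>G\<close> shows that the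
  images of the nearly open maps \<open>\<phi>\<close> and \<open>k \<phi>\<close> meet for every \<open>k\<close> in \<open>B\<close>, so that \<open>k\<close> lies in
  the image of \<open>\<phi>\<close>.
\<close>

section \<open>Nearly open maps from completely metrizable spaces\<close>

text \<open>Openness weakened by a closure. A covering argument in the target only controls closures
  of images, and completeness of the source makes up for the difference later.\<close>

definition nearly_open_map :: "'a topology \<Rightarrow> 'b topology \<Rightarrow> ('a \<Rightarrow> 'b) \<Rightarrow> bool" where
  "nearly_open_map X Y f \<longleftrightarrow>
     (\<forall>U. openin X U \<longrightarrow> f ` U \<subseteq> Y interior_of (Y closure_of (f ` U)))"

text \<open>Homeomorphisms commute with closure and interior; continuity of \<open>f\<close> places
  the image inside \<open>Y\<close>, where these rules apply. This serves for the translates of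
  \<open>\<phi>\<close> by elements of \<open>B\<close>.\<close>

lemma nearly_open_map_compose_homeomorphic:
  assumes f: "nearly_open_map X Y f" and cf: "continuous_map X Y f" and h: "homeomorphic_map Y Z h"
  shows "nearly_open_map X Z (\<lambda>x. h (f x))"
  unfolding nearly_open_map_def
proof (intro allI impI)
  fix U assume U: "openin X U"
  have sub: "f ` U \<subseteq> topspace Y"
    using continuous_map_image_subset_topspace[OF cf] openin_subset[OF U] by blast
  have "Z interior_of (Z closure_of (h ` f ` U)) = h ` (Y interior_of (Y closure_of (f ` U)))"
    using homeomorphic_map_closure_of[OF h sub]
      homeomorphic_map_interior_of[OF h closure_of_subset_topspace] by metis
  moreover have "f ` U \<subseteq> Y interior_of (Y closure_of (f ` U))"
    using f U by (auto simp: nearly_open_map_def)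
  ultimately show "(\<lambda>x. h (f x)) ` U \<subseteq> Z interior_of (Z closure_of ((\<lambda>x. h (f x)) ` U))"
    by (metis image_image image_mono)
qed

text \<open>Cantor's intersection theorem for the closed balls. Convergence is phrased with
  neighbourhoods that swallow whole balls, because the later argument follows images of balls and
  not only of their centres.\<close>

lemma (in Metric_space) nested_balls_converge:
  fixes x :: "nat \<Rightarrow> 'a" and r :: "nat \<Rightarrow> real"
  assumes "mcomplete"
    and x: "\<And>n. x n \<in> M" and r0: "\<And>n. 0 < r n" and r: "\<And>n. r n \<le> inverse (real (Suc n))"
    and nest: "\<And>n. mcball (x (Suc n)) (r (Suc n)) \<subseteq> mball (x n) (r n)"
  obtains a where "a \<in> M"
    and "\<And>U. openin mtopology U \<Longrightarrow> a \<in> U \<Longrightarrow> \<exists>N. \<forall>n\<ge>N. mball (x n) (r n) \<subseteq> U"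
proof -
  define C where "C n = mcball (x n) (r n)" for n
  have small: "\<exists>N. \<forall>n\<ge>N. r n < e" if "e > 0" for e
  proof -
    obtain N where N: "inverse (real (Suc N)) < e"
      using reals_Archimedean \<open>e > 0\<close> by blast
    have "r n < e" if "n \<ge> N" for n
    proof -
      have "inverse (real (Suc n)) \<le> inverse (real (Suc N))"
        using that by (intro le_imp_inverse_le) auto
      with N r[of n] show ?thesis by linarith
    qed
    then show ?thesis by blast
  qed
  have "decseq C"
    unfolding C_def by (intro decseq_SucI) (use nest mball_subset_mcball in blast)
  moreover have "C n \<noteq> {}" for n
    using x[of n] r0[of n] by (auto simp: C_def mcball_eq_empty)
  moreover have "\<exists>n a. C n \<subseteq> mcball a e" if "e > 0" for e
  proof -
    obtain N where "r N < e" using small \<open>e > 0\<close> by blast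
    then have "C N \<subseteq> mcball (x N) e" unfolding C_def by (intro mcball_subset_concentric) auto
    then show ?thesis by blast
  qed
  moreover have "closedin mtopology (C n)" for n
    by (simp add: C_def)
  ultimately have "\<Inter> (range C) \<noteq> {}"
    using \<open>mcomplete\<close> unfolding mcomplete_nest by blast
  then obtain a where a: "\<And>n. a \<in> C n" by blast
  have aM: "a \<in> M" using a[of 0] by (auto simp: C_def)
  have "\<exists>N. \<forall>n\<ge>N. mball (x n) (r n) \<subseteq> U" if U: "openin mtopology U" "a \<in> U" for U
  proof -
    obtain e where e: "e > 0" "mball a e \<subseteq> U"
      using U by (auto simp: openin_mtopology)
    obtain N where N: "\<And>n. n \<ge> N \<Longrightarrow> r n < e / 2"
      using small[of "e/2"] e by auto
    have "mball (x n) (r n) \<subseteq> U" if "n \<ge> N" for n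
    proof -
      have "mball (x n) (r n) \<subseteq> mball a e"
      proof
        fix y assume y: "y \<in> mball (x n) (r n)"
        \<comment> \<open>\<open>a\<close> lies in every closed ball, so both distances from
          \<open>x n\<close> are at most \<open>r n < e / 2\<close>.\<close>
        have "d a y \<le> d (x n) a + d (x n) y"
          using triangle[of a "x n" y] y aM by (simp add: commute)
        then show "y \<in> mball a e"
          using y a[of n] N[OF that] aM by (auto simp: C_def)
      qed
      with e show ?thesis by blast
    qed
    then show ?thesis by blast
  qed
  with aM that show ?thesis by blast
qed

text \<open>The bound \<open>e\<close> lets the radii be forced to zero while the nesting is
  kept.\<close>

lemma (in Metric_space) small_mcball_in_mball:
  assumes "z \<in> mball x r" "e > 0"
  obtains r' where "0 < r'" "r' \<le> e" "mcball z r' \<subseteq> mball x r"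
proof -
  obtain s where s: "0 < s" "mcball z s \<subseteq> mball x r"
    using assms(1) openin_mball[of x r] unfolding openin_mtopology_mcball by blast
  have "mcball z (min s e) \<subseteq> mcball z s" by (intro mcball_subset_concentric) auto
  with s that[of "min s e"] \<open>e > 0\<close> show ?thesis by auto
qed

lemma interior_closure_meets:
  assumes "z \<in> Z interior_of (Z closure_of A)" "openin Z W" "z \<in> W"
  obtains a where "a \<in> A" "a \<in> W"
  using assms interior_of_subset[of Z "Z closure_of A"] by (auto simp: in_closure_of subset_iff)

text \<open>Near openness makes \<open>p x\<close> interior to the closure of the image of every
  ball about \<open>x\<close>, and likewise for \<open>q\<close>. Balls in \<open>X\<close> and
  \<open>Y\<close> can therefore be shrunk alternately while the closures of their images stay
  interlocked. Completeness gives limits \<open>a\<close> and \<open>b\<close>; disjoint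
  neighbourhoods of \<open>p a\<close> and \<open>q b\<close> would break the interlocking.\<close>

lemma nearly_open_maps_images_meet:
  assumes X: "completely_metrizable_space X" and Y: "completely_metrizable_space Y"
    and Z: "Hausdorff_space Z"
    and p: "continuous_map X Z p" "nearly_open_map X Z p"
    and q: "continuous_map Y Z q" "nearly_open_map Y Z q"
    and dense: "Z closure_of (p ` topspace X) = topspace Z"
    and ne: "topspace Y \<noteq> {}"
  shows "\<exists>x\<in>topspace X. \<exists>y\<in>topspace Y. p x = q y"
proof -
  obtain M d where M: "Metric_space M d" "Metric_space.mcomplete M d"
    and XM: "X = Metric_space.mtopology M d"
    using X unfolding completely_metrizable_space_def by blast
  obtain N e where N: "Metric_space N e" "Metric_space.mcomplete N e"
    and YN: "Y = Metric_space.mtopology N e"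
    using Y unfolding completely_metrizable_space_def by blast
  interpret X: Metric_space M d by fact
  interpret Y: Metric_space N e by fact
  define ic where "ic A = Z interior_of (Z closure_of A)" for A
  have ic_open: "openin Z (ic A)" for A by (simp add: ic_def)
  have pin: "p x \<in> ic (p ` X.mball x r)" if "x \<in> M" "r > 0" for x r
  proof -
    have "p ` X.mball x r \<subseteq> ic (p ` X.mball x r)"
      using p(2) X.openin_mball unfolding nearly_open_map_def ic_def XM by blast
    then show ?thesis using that by auto
  qed
  have qin: "q y \<in> ic (q ` Y.mball y r)" if "y \<in> N" "r > 0" for y r
  proof -
    have "q ` Y.mball y r \<subseteq> ic (q ` Y.mball y r)"
      using q(2) Y.openin_mball unfolding nearly_open_map_def ic_def YN by blast
    then show ?thesis using that by auto
  qed
  \<comment> \<open>\<open>p x\<close> is adherent to the \<open>q\<close>-image of the ball about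
    \<open>y\<close>, and by \<open>pin\<close> it has an open neighbourhood inside the closure of
    the \<open>p\<close>-image of the ball about \<open>x\<close>. So some \<open>y'\<close> in the
    first ball is sent into that neighbourhood. \<open>link_x\<close> is the mirror image.\<close>
  have link_y: "\<exists>y'\<in>Y.mball y s. q y' \<in> ic (p ` X.mball x r)"
    if "x \<in> M" "r > 0" "p x \<in> ic (q ` Y.mball y s)" for x r y s
    using interior_closure_meets[OF that(3)[unfolded ic_def] ic_open pin[OF that(1,2)]] by blast
  have link_x: "\<exists>x'\<in>X.mball x r. p x' \<in> ic (q ` Y.mball y s)"
    if "y \<in> N" "s > 0" "q y \<in> ic (p ` X.mball x r)" for x r y s
    using interior_closure_meets[OF that(3)[unfolded ic_def] ic_open qin[OF that(1,2)]] by blast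
  \<comment> \<open>Only the link from \<open>y\<close> to the ball about \<open>x\<close> is
    carried along; the reverse link is regained in the middle of each step. The bound on the radii
    and the nesting in \<open>Q\<close> are what convergence of the balls requires.\<close>
  define P where "P n = (\<lambda>(x, r, y, s). x \<in> M \<and> y \<in> N \<and> 0 < r \<and> 0 < s
      \<and> r \<le> inverse (real (Suc n)) \<and> s \<le> inverse (real (Suc n))
      \<and> q y \<in> ic (p ` X.mball x r))" for n :: nat
  define Q where "Q = (\<lambda>(x, r, y, s) (x', r', y', s').
      X.mcball x' r' \<subseteq> X.mball x r \<and> Y.mcball y' s' \<subseteq> Y.mball y s)"
  have "\<exists>f. \<forall>n. P n (f n) \<and> Q (f n) (f (Suc n))"
  proof (rule dependent_nat_choice)
    obtain y0 where y0: "y0 \<in> N" using ne by (auto simp: YN)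
    have q0: "q y0 \<in> Z closure_of (p ` M)"
      using q(1) y0 dense by (auto simp: continuous_map_def XM YN)
    \<comment> \<open>The point \<open>q y0\<close> has an open neighbourhood inside the closure of
      the \<open>q\<close>-image of its unit ball, and density of the image of \<open>p\<close> puts
      some \<open>p x0\<close> there. Radius 1 is exactly the bound for
      \<open>n = 0\<close>.\<close>
    obtain x0 where x0: "x0 \<in> M" "p x0 \<in> ic (q ` Y.mball y0 1)"
      using q0 ic_open[of "q ` Y.mball y0 1"] qin[OF y0, of 1] unfolding in_closure_of by auto
    obtain y1 where "y1 \<in> Y.mball y0 1" "q y1 \<in> ic (p ` X.mball x0 1)"
      using link_y[OF x0(1) zero_less_one x0(2)] by blast
    then have "P 0 (x0, 1, y1, 1)"
      using x0 by (auto simp: P_def)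
    then show "\<exists>t. P 0 t" by blast
  next
    fix t n assume t: "P n t"
    obtain x r y s where tt: "t = (x, r, y, s)" by (metis prod_cases4)
    have i: "inverse (real (Suc (Suc n))) > 0" by simp
    have *: "x \<in> M" "y \<in> N" "0 < r" "0 < s" "q y \<in> ic (p ` X.mball x r)"
      using t by (auto simp: P_def tt)
    \<comment> \<open>The ball about \<open>x'\<close> is shrunk before \<open>y'\<close> is chosen,
      so that the new link refers to the small radius \<open>r'\<close>.\<close>
    obtain x' where x': "x' \<in> X.mball x r" "p x' \<in> ic (q ` Y.mball y s)"
      using link_x * by blast
    obtain r' where r': "0 < r'" "r' \<le> inverse (real (Suc (Suc n)))" "X.mcball x' r' \<subseteq> X.mball x r"
      using X.small_mcball_in_mball[OF x'(1) i] by blast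
    obtain y' where y': "y' \<in> Y.mball y s" "q y' \<in> ic (p ` X.mball x' r')"
      using link_y[OF _ r'(1) x'(2)] x'(1) by auto
    obtain s' where s': "0 < s'" "s' \<le> inverse (real (Suc (Suc n)))" "Y.mcball y' s' \<subseteq> Y.mball y s"
      using Y.small_mcball_in_mball[OF y'(1) i] by blast
    have "P (Suc n) (x', r', y', s') \<and> Q t (x', r', y', s')"
      using x' r' y' s' by (auto simp: P_def Q_def tt)
    then show "\<exists>t'. P (Suc n) t' \<and> Q t t'" by blast
  qed
  then obtain f where f: "\<And>n. P n (f n)" "\<And>n. Q (f n) (f (Suc n))" by blast
  define x r y s where "x n = fst (f n)" and "r n = fst (snd (f n))"
    and "y n = fst (snd (snd (f n)))" and "s n = snd (snd (snd (f n)))" for n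
  have ff: "f n = (x n, r n, y n, s n)" for n by (simp add: x_def r_def y_def s_def)
  have xM: "x n \<in> M" and yN: "y n \<in> N" and r0: "0 < r n" and s0: "0 < s n"
    and r: "r n \<le> inverse (real (Suc n))" and s: "s n \<le> inverse (real (Suc n))"
    and link: "q (y n) \<in> ic (p ` X.mball (x n) (r n))" for n
    using f(1)[of n] unfolding P_def ff by auto
  have nx: "X.mcball (x (Suc n)) (r (Suc n)) \<subseteq> X.mball (x n) (r n)"
    and ny: "Y.mcball (y (Suc n)) (s (Suc n)) \<subseteq> Y.mball (y n) (s n)" for n
    using f(2)[of n] unfolding Q_def ff by auto
  obtain a where a: "a \<in> M"
    "\<And>U. openin X U \<Longrightarrow> a \<in> U \<Longrightarrow> \<exists>n0. \<forall>n\<ge>n0. X.mball (x n) (r n) \<subseteq> U"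
    using X.nested_balls_converge[OF M(2) xM r0 r nx] unfolding XM by blast
  obtain b where b: "b \<in> N"
    "\<And>U. openin Y U \<Longrightarrow> b \<in> U \<Longrightarrow> \<exists>n0. \<forall>n\<ge>n0. Y.mball (y n) (s n) \<subseteq> U"
    using Y.nested_balls_converge[OF N(2) yN s0 s ny] unfolding YN by blast
  have "p a = q b"
  proof (rule ccontr)
    assume ne: "p a \<noteq> q b"
    have "p a \<in> topspace Z" "q b \<in> topspace Z"
      using p(1) q(1) a(1) b(1) by (auto simp: continuous_map_def XM YN)
    then obtain U V where UV: "openin Z U" "openin Z V" "p a \<in> U" "q b \<in> V" "disjnt U V"
      using Z ne unfolding Hausdorff_space_def by blast
    have oU: "openin X {x \<in> M. p x \<in> U}"
      using openin_continuous_map_preimage[OF p(1) UV(1)] by (simp add: XM)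
    have oV: "openin Y {y \<in> N. q y \<in> V}"
      using openin_continuous_map_preimage[OF q(1) UV(2)] by (simp add: YN)
    obtain n1 where n1: "\<And>n. n \<ge> n1 \<Longrightarrow> X.mball (x n) (r n) \<subseteq> {x \<in> M. p x \<in> U}"
      using a(2)[OF oU] a(1) UV by auto
    obtain n2 where n2: "\<And>n. n \<ge> n2 \<Longrightarrow> Y.mball (y n) (s n) \<subseteq> {y \<in> N. q y \<in> V}"
      using b(2)[OF oV] b(1) UV by auto
    define n where "n = max n1 n2"
    \<comment> \<open>\<open>y n\<close> lies in its own ball, which \<open>q\<close> maps into
      \<open>V\<close>; by the link, \<open>q (y n)\<close> is also adherent to the
      \<open>p\<close>-image of the other ball, which lies in \<open>U\<close>.\<close>
    have "q (y n) \<in> V"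
      using n2[of n] yN[of n] s0[of n] by (auto simp: n_def)
    then obtain c where "c \<in> p ` X.mball (x n) (r n)" "c \<in> V"
      using interior_closure_meets[OF link[of n, unfolded ic_def] UV(2)] by blast
    then show False
      using n1[of n] UV(5) by (auto simp: n_def disjnt_iff)
  qed
  then show ?thesis using a(1) b(1) by (auto simp: XM YN)
qed

section \<open>Topological groups\<close>

lemma topological_group_continuous_mult:
  assumes "topological_group G T" "continuous_map X T f" "continuous_map X T g"
  shows "continuous_map X T (\<lambda>x. f x \<otimes>\<^bsub>G\<^esub> g x)"
proof -
  have "continuous_map X (prod_topology T T) (\<lambda>x. (f x, g x))"
    using assms by (simp add: continuous_map_paired)
  then show ?thesis
    using assms continuous_map_compose[of X "prod_topology T T" "\<lambda>x. (f x, g x)" T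
        "\<lambda>p. fst p \<otimes>\<^bsub>G\<^esub> snd p"]
    by (simp add: topological_group_def o_def)
qed

lemma topological_group_continuous_inv:
  assumes "topological_group G T" "continuous_map X T f"
  shows "continuous_map X T (\<lambda>x. inv\<^bsub>G\<^esub> f x)"
  using assms continuous_map_compose[of X T f T "\<lambda>x. inv\<^bsub>G\<^esub> x"]
  by (simp add: topological_group_def o_def)

lemma topological_group_homeomorphic_translation:
  assumes T: "topological_group G T" and k: "k \<in> carrier G"
  shows "homeomorphic_map T T (\<lambda>x. k \<otimes>\<^bsub>G\<^esub> x)"
proof -
  interpret group G using T by (simp add: topological_group_def)
  have ts: "topspace T = carrier G" using T by (simp add: topological_group_def)
  have c: "continuous_map T T (\<lambda>x. c \<otimes>\<^bsub>G\<^esub> x)" if "c \<in> carrier G" for c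
    using that ts by (intro topological_group_continuous_mult[OF T]) auto
  have "homeomorphic_maps T T (\<lambda>x. k \<otimes>\<^bsub>G\<^esub> x) (\<lambda>x. inv\<^bsub>G\<^esub> k \<otimes>\<^bsub>G\<^esub> x)"
    using c k ts by (auto simp: homeomorphic_maps_def m_assoc[symmetric])
  then show ?thesis by (rule homeomorphic_maps_map[THEN iffD1, THEN conjunct1])
qed

text \<open>The closure of a product is the product of the closures, so membership checked on
  \<open>A\<close> and \<open>C\<close> passes to the limit.\<close>

lemma continuous_binary_closure:
  assumes "continuous_map (prod_topology X Y) Z (\<lambda>p. f (fst p) (snd p))"
    and "x \<in> X closure_of A" "y \<in> Y closure_of C"
    and "\<And>a c. a \<in> A \<Longrightarrow> c \<in> C \<Longrightarrow> f a c \<in> D"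
  shows "f x y \<in> Z closure_of D"
proof -
  have "(x, y) \<in> prod_topology X Y closure_of (A \<times> C)"
    using assms by (simp add: closure_of_Times)
  then have "f x y \<in> Z closure_of ((\<lambda>p. f (fst p) (snd p)) ` (A \<times> C))"
    using continuous_map_image_closure_subset[OF assms(1), of "A \<times> C"] by force
  moreover have "(\<lambda>p. f (fst p) (snd p)) ` (A \<times> C) \<subseteq> D" using assms(4) by auto
  ultimately show ?thesis using closure_of_mono by blast
qed

text \<open>A box around \<open>(x, x)\<close> is cut down to a square, so that one \<open>U\<close>
  serves both arguments. At the identity this halves neighbourhoods of a group.\<close>

lemma continuous_binary_nbhd:
  assumes "continuous_map (prod_topology X X) Z (\<lambda>p. f (fst p) (snd p))"
    and "openin Z V" "f x x \<in> V" "x \<in> topspace X"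
  obtains U where "openin X U" "x \<in> U" "\<And>a b. a \<in> U \<Longrightarrow> b \<in> U \<Longrightarrow> f a b \<in> V"
proof -
  have "openin (prod_topology X X) {p \<in> topspace (prod_topology X X). f (fst p) (snd p) \<in> V}"
    using openin_continuous_map_preimage[OF assms(1,2)] .
  moreover have "(x, x) \<in> {p \<in> topspace (prod_topology X X). f (fst p) (snd p) \<in> V}"
    using assms by simp
  ultimately obtain U1 U2 where U: "openin X U1" "openin X U2" "x \<in> U1" "x \<in> U2"
    "U1 \<times> U2 \<subseteq> {p \<in> topspace (prod_topology X X). f (fst p) (snd p) \<in> V}"
    unfolding openin_prod_topology_alt by meson
  show ?thesis
  proof (rule that)
    show "openin X (U1 \<inter> U2)" using U by blast
    show "x \<in> U1 \<inter> U2" using U by blast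
    show "f a b \<in> V" if "a \<in> U1 \<inter> U2" "b \<in> U1 \<inter> U2" for a b
      using U(5) that by auto
  qed
qed

lemma topological_group_closure_subgroup:
  assumes T: "topological_group G T" and H: "subgroup H G"
  shows "subgroup (T closure_of H) G"
proof -
  interpret group G using T by (simp add: topological_group_def)
  have ts: "topspace T = carrier G" using T by (simp add: topological_group_def)
  interpret H: subgroup H G by fact
  show ?thesis
  proof (rule subgroupI)
    show sub: "T closure_of H \<subseteq> carrier G" using closure_of_subset_topspace[of T H] ts by simp
    show "T closure_of H \<noteq> {}"
      using closure_of_subset[of H T] H.subset[folded ts] subgroup.one_closed[OF H] by blast
    show "inv\<^bsub>G\<^esub> x \<in> T closure_of H" if "x \<in> T closure_of H" for x
    proof -
      have "inv\<^bsub>G\<^esub> x \<in> T closure_of ((\<lambda>x. inv\<^bsub>G\<^esub> x) ` H)"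
        using that T continuous_map_image_closure_subset[of T T "\<lambda>x. inv\<^bsub>G\<^esub> x" H]
        by (auto simp: topological_group_def)
      moreover have "(\<lambda>x. inv\<^bsub>G\<^esub> x) ` H \<subseteq> H" by auto
      ultimately show ?thesis using closure_of_mono by blast
    qed
    show "x \<otimes>\<^bsub>G\<^esub> y \<in> T closure_of H" if "x \<in> T closure_of H" "y \<in> T closure_of H" for x y
      using continuous_binary_closure[of T T T "\<lambda>x y. x \<otimes>\<^bsub>G\<^esub> y" x H y H H] that T
      by (auto simp: topological_group_def)
  qed
qed

section \<open>Compact groups: closed subgroups and copies on another type\<close>

lemma compact_group_closed_subgroup:
  assumes K: "compact_group K R" and H: "subgroup H K" "closedin R H"
  shows "compact_group (K\<lparr>carrier := H\<rparr>) (subtopology R H)"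
proof -
  have T: "topological_group K R" using K by (simp add: compact_group_def)
  interpret group K using T by (simp add: topological_group_def)
  interpret H: subgroup H K by fact
  have ts: "topspace R = carrier K" using T by (simp add: topological_group_def)
  have tH: "topspace (subtopology R H) = H" using H.subset by (auto simp: ts)
  let ?P = "prod_topology (subtopology R H) (subtopology R H)"
  have id: "continuous_map (subtopology R H) R (\<lambda>x. x)"
    using continuous_map_from_subtopology[of R R id H] by (simp add: id_def)
  have f: "continuous_map ?P R fst" "continuous_map ?P R snd"
    using continuous_map_compose[OF continuous_map_fst id]
      continuous_map_compose[OF continuous_map_snd id] by (simp_all add: o_def)
  have "continuous_map ?P R (\<lambda>p. fst p \<otimes>\<^bsub>K\<^esub> snd p)"
    by (rule topological_group_continuous_mult[OF T f])
  then have m: "continuous_map ?P (subtopology R H) (\<lambda>p. fst p \<otimes>\<^bsub>K\<^esub> snd p)"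
    by (rule continuous_map_into_subtopology) auto
  have "continuous_map (subtopology R H) R (\<lambda>x. inv\<^bsub>K\<^esub> x)"
    by (rule topological_group_continuous_inv[OF T id])
  then have "continuous_map (subtopology R H) (subtopology R H) (\<lambda>x. inv\<^bsub>K\<^esub> x)"
    by (rule continuous_map_into_subtopology) auto
  \<comment> \<open>Inversion in the restricted record is a different function; it agrees with
    inversion in \<open>K\<close> on \<open>H\<close>.\<close>
  then have i: "continuous_map (subtopology R H) (subtopology R H) (\<lambda>x. inv\<^bsub>K\<lparr>carrier := H\<rparr>\<^esub> x)"
    by (rule continuous_map_eq) (simp add: H(1))
  have "compact_space (subtopology R H)"
    using K H(2) by (intro compact_space_subtopology closedin_compact_space) (auto simp: compact_group_def)
  moreover have "Hausdorff_space (subtopology R H)"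
    using K by (simp add: compact_group_def Hausdorff_space_subtopology)
  moreover have "group (K\<lparr>carrier := H\<rparr>)"
    by (rule H.subgroup_is_group) (rule is_group)
  ultimately show ?thesis
    using m i tH by (simp add: compact_group_def topological_group_def)
qed

text \<open>Transport of structure along \<open>\<iota>\<close>. The copy is a plain
  \<open>'c monoid\<close>, the kind of group over which the universal property ranges.\<close>

lemma compact_group_transfer_type:
  fixes K :: "('b, 'm) monoid_scheme" and \<iota> :: "'b \<Rightarrow> 'c"
  assumes K: "compact_group K R" and inj: "inj \<iota>"
  obtains K' :: "'c monoid" and R' j where "compact_group K' R'"
    and "cont_hom K R K' R' \<iota>" and "cont_hom K' R' K R j" and "\<And>x. j (\<iota> x) = x"
proof -
  have T: "topological_group K R" using K by (simp add: compact_group_def)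
  interpret group K using T by (simp add: topological_group_def)
  have ts: "topspace R = carrier K" using T by (simp add: topological_group_def)
  define j where "j = inv_into UNIV \<iota>"
  have ji [simp]: "j (\<iota> x) = x" for x using inj by (simp add: j_def)
  define K' where "K' = \<lparr>carrier = \<iota> ` carrier K, monoid.mult = (\<lambda>x y. \<iota> (j x \<otimes>\<^bsub>K\<^esub> j y)), one = \<iota> \<one>\<^bsub>K\<^esub>\<rparr>"
  \<comment> \<open>The pullback makes \<open>j\<close> continuous by construction, and
    \<open>\<iota>\<close> continuous because \<open>j\<close> after \<open>\<iota>\<close> is the
    identity.\<close>
  define R' where "R' = pullback_topology (\<iota> ` carrier K) j R"
  have cK: "carrier K' = \<iota> ` carrier K" and mK: "x \<otimes>\<^bsub>K'\<^esub> y = \<iota> (j x \<otimes>\<^bsub>K\<^esub> j y)"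
    and oK: "\<one>\<^bsub>K'\<^esub> = \<iota> \<one>\<^bsub>K\<^esub>" for x y
    by (simp_all add: K'_def)
  have tR': "topspace R' = \<iota> ` carrier K"
    by (auto simp: R'_def topspace_pullback_topology ts)
  have cj: "continuous_map R' R j"
    using continuous_map_pullback[OF continuous_map_id, of "\<iota> ` carrier K" j R] by (simp add: R'_def)
  have ci: "continuous_map R R' \<iota>"
    unfolding R'_def
    by (rule continuous_map_pullback') (auto simp: o_def ts)
  have g: "group K'"
  proof (rule groupI)
    fix x assume "x \<in> carrier K'"
    then obtain a where a: "a \<in> carrier K" "x = \<iota> a" by (auto simp: cK)
    then show "\<exists>y\<in>carrier K'. y \<otimes>\<^bsub>K'\<^esub> x = \<one>\<^bsub>K'\<^esub>"
      by (intro bexI[of _ "\<iota> (inv\<^bsub>K\<^esub> a)"]) (auto simp: cK mK oK)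
  qed (auto simp: cK mK oK m_assoc)
  have invK: "inv\<^bsub>K'\<^esub> x = \<iota> (inv\<^bsub>K\<^esub> (j x))" if "x \<in> carrier K'" for x
    using that by (intro group.inv_equality[OF g]) (auto simp: cK mK oK)
  have "continuous_map (prod_topology R' R') R (\<lambda>p. j (fst p) \<otimes>\<^bsub>K\<^esub> j (snd p))"
    using continuous_map_compose[OF continuous_map_fst cj] continuous_map_compose[OF continuous_map_snd cj]
    by (intro topological_group_continuous_mult[OF T]) (simp_all add: o_def)
  then have m: "continuous_map (prod_topology R' R') R' (\<lambda>p. fst p \<otimes>\<^bsub>K'\<^esub> snd p)"
    using continuous_map_compose[OF _ ci] by (fastforce simp: mK o_def)
  have "continuous_map R' R' (\<lambda>x. \<iota> (inv\<^bsub>K\<^esub> (j x)))"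
    using continuous_map_compose[OF topological_group_continuous_inv[OF T cj] ci] by (simp add: o_def)
  then have i: "continuous_map R' R' (\<lambda>x. inv\<^bsub>K'\<^esub> x)"
    by (rule continuous_map_eq) (auto simp: invK tR' cK)
  have hm: "homeomorphic_maps R R' \<iota> j"
    using ci cj by (auto simp: homeomorphic_maps_def tR')
  then have hs: "R homeomorphic_space R'" unfolding homeomorphic_space_def by blast
  have "compact_group K' R'"
    using g m i K homeomorphic_compact_space[OF hs] homeomorphic_Hausdorff_space[OF hs]
    by (simp add: compact_group_def topological_group_def tR' cK)
  moreover have "cont_hom K R K' R' \<iota>"
    using ci by (auto simp: cont_hom_def hom_def cK mK)
  moreover have "cont_hom K' R' K R j"
    using cj by (auto simp: cont_hom_def hom_def cK mK)
  ultimately show ?thesis using that ji by blast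
qed

section \<open>Roelcke precompact groups and compact groups\<close>

lemma cont_hom_compose:
  assumes "cont_hom G T H S f" "cont_hom H S K R g"
  shows "cont_hom G T K R (\<lambda>x. g (f x))"
  using assms continuous_map_compose[of T S f R g] hom_compose[of f G H g K]
  by (simp add: cont_hom_def o_def)

text \<open>The universal property only concerns groups on the type \<open>'c\<close>, so both the closure of the
  image and \<open>B\<close> have to be moved into \<open>'c\<close> along an injection.\<close>

lemma Bohr_compactification_dense:
  fixes B :: "('b, 'n) monoid_scheme" and \<iota> :: "'b \<Rightarrow> 'c"
  assumes G: "topological_group G T" and bohr: "Bohr_compactification_wrt G T \<phi> B S TYPE('c)" and inj: "inj \<iota>"
  shows "S closure_of (\<phi> ` carrier G) = carrier B"
proof -
  define L where "L = S closure_of (\<phi> ` carrier G)"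
  have B: "compact_group B S" and \<phi>: "cont_hom G T B S \<phi>"
    using bohr by (auto simp: Bohr_compactification_wrt_def)
  have T: "topological_group B S" using B by (simp add: compact_group_def)
  have gG: "group G" and tsG: "topspace T = carrier G" using G by (auto simp: topological_group_def)
  have gB: "group B" and ts: "topspace S = carrier B" using T by (auto simp: topological_group_def)
  interpret group_hom G B \<phi>
    using gG gB \<phi> by (simp add: group_hom_def group_hom_axioms_def cont_hom_def)
  have sub: "subgroup L B"
    unfolding L_def by (rule topological_group_closure_subgroup[OF T img_is_subgroup])
  let ?L = "B\<lparr>carrier := L\<rparr>" and ?SL = "subtopology S L"
  have cL: "compact_group ?L ?SL"
    by (rule compact_group_closed_subgroup[OF B sub]) (simp add: L_def)
  have imL: "\<phi> ` carrier G \<subseteq> L"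
    unfolding L_def by (rule closure_of_subset) (simp add: ts image_subset_iff)
  have \<phi>L: "cont_hom G T ?L ?SL \<phi>"
  proof -
    have "\<phi> \<in> topspace T \<rightarrow> L"
      unfolding tsG using imL by blast
    then show ?thesis using \<phi> imL
      by (auto simp: cont_hom_def hom_def continuous_map_in_subtopology)
  qed
  have incl: "cont_hom ?L ?SL B S (\<lambda>x. x)"
    using subgroup.subset[OF sub] continuous_map_from_subtopology[of S S id L]
    by (auto simp: cont_hom_def hom_def id_def)
  obtain L' :: "'c monoid" and RL jL where L': "compact_group L' RL"
    "cont_hom ?L ?SL L' RL \<iota>" "cont_hom L' RL ?L ?SL jL" "\<And>x. jL (\<iota> x) = x"
    using compact_group_transfer_type[OF cL inj] by metis
  obtain B' :: "'c monoid" and RB jB where B': "compact_group B' RB"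
    "cont_hom B S B' RB \<iota>" "cont_hom B' RB B S jB" "\<And>x. jB (\<iota> x) = x"
    using compact_group_transfer_type[OF B inj] by metis
  \<comment> \<open>Existence in the universal property, applied to \<open>\<phi>\<close> regarded
    as a map into the copy \<open>L'\<close> of \<open>L\<close>.\<close>
  obtain h where h: "cont_hom B S L' RL h" "\<And>g. g \<in> carrier G \<Longrightarrow> \<iota> (\<phi> g) = h (\<phi> g)"
    using bohr L'(1) cont_hom_compose[OF \<phi>L L'(2)] unfolding Bohr_compactification_wrt_def by blast
  have hL: "cont_hom B S ?L ?SL (\<lambda>x. jL (h x))"
    by (rule cont_hom_compose[OF h(1) L'(3)])
  \<comment> \<open>This map through \<open>L\<close> and \<open>\<iota>\<close> itself both factor
    the map \<open>\<iota> (\<phi> g)\<close> into \<open>B'\<close>. Uniqueness makes them equal,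
    so every \<open>x\<close> in \<open>B\<close> is \<open>jL (h x)\<close>, a point of
    \<open>L\<close>.\<close>
  have h': "cont_hom B S B' RB (\<lambda>x. \<iota> (jL (h x)))"
    by (rule cont_hom_compose[OF cont_hom_compose[OF hL incl] B'(2)])
  have fac: "\<forall>g\<in>carrier G. \<iota> (\<phi> g) = \<iota> (jL (h (\<phi> g)))"
    using h(2) L'(4) by metis
  have uniq: "\<forall>x\<in>carrier B. h1 x = h2 x"
    if "cont_hom B S B' RB h1" "\<forall>g\<in>carrier G. \<iota> (\<phi> g) = h1 (\<phi> g)"
      "cont_hom B S B' RB h2" "\<forall>g\<in>carrier G. \<iota> (\<phi> g) = h2 (\<phi> g)" for h1 h2
  proof -
    have "compact_group B' RB \<and> cont_hom G T B' RB (\<lambda>g. \<iota> (\<phi> g))"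
      using B'(1) cont_hom_compose[OF \<phi> B'(2)] ..
    then show ?thesis
      using bohr that unfolding Bohr_compactification_wrt_def by blast
  qed
  have "\<forall>x\<in>carrier B. \<iota> (jL (h x)) = \<iota> x"
    by (rule uniq[OF h' fac B'(2)]) simp
  then have "jL (h x) = x" if "x \<in> carrier B" for x using that injD[OF inj] by blast
  moreover have "jL (h x) \<in> L" if "x \<in> carrier B" for x
    using hL that by (auto simp: cont_hom_def hom_def)
  ultimately have "carrier B \<subseteq> L" by (metis subsetI)
  then show ?thesis using subgroup.subset[OF sub] by (auto simp: L_def)
qed

text \<open>Since \<open>F\<close> is finite, the closed pieces that miss the identity have a closed
  union, and deleting them leaves an open set around the identity.\<close>

lemma Roelcke_precompact_closure_nbhd:
  assumes G: "topological_group G T" and RP: "Roelcke_precompact G T" and B: "compact_group B S"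
    and \<phi>: "cont_hom G T B S \<phi>" and dense: "S closure_of (\<phi> ` carrier G) = carrier B"
    and V: "openin T V" "\<one>\<^bsub>G\<^esub> \<in> V"
  obtains W where "openin S W" "\<one>\<^bsub>B\<^esub> \<in> W" "W \<subseteq> S closure_of (\<phi> ` V)"
proof -
  have TB: "topological_group B S" and cS: "compact_space S" and hS: "Hausdorff_space S"
    using B by (auto simp: compact_group_def)
  have gG: "group G" and tsG: "topspace T = carrier G" using G by (auto simp: topological_group_def)
  have gB: "group B" and tsB: "topspace S = carrier B" using TB by (auto simp: topological_group_def)
  interpret group_hom G B \<phi>
    using gG gB \<phi> by (simp add: group_hom_def group_hom_axioms_def cont_hom_def)
  note fs = continuous_map_fst continuous_map_snd
  obtain V1 where V1: "openin T V1" "\<one>\<^bsub>G\<^esub> \<in> V1"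
    "\<And>a b. a \<in> V1 \<Longrightarrow> b \<in> V1 \<Longrightarrow> a \<otimes>\<^bsub>G\<^esub> b \<in> V"
    using continuous_binary_nbhd[of T T "\<lambda>a b. a \<otimes>\<^bsub>G\<^esub> b" V "\<one>\<^bsub>G\<^esub>",
        OF topological_group_continuous_mult[OF G fs] V(1)] V(2) tsG by auto
  \<comment> \<open>Both one-sided quotients are needed, since \<open>G\<close> need not be
    commutative: the left factors of a piece will produce \<open>a' inv a\<close> and the right
    factors \<open>inv b b'\<close>.\<close>
  obtain U1 where U1: "openin T U1" "\<one>\<^bsub>G\<^esub> \<in> U1"
    "\<And>a b. a \<in> U1 \<Longrightarrow> b \<in> U1 \<Longrightarrow> a \<otimes>\<^bsub>G\<^esub> inv\<^bsub>G\<^esub> b \<in> V1"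
    using continuous_binary_nbhd[of T T "\<lambda>a b. a \<otimes>\<^bsub>G\<^esub> inv\<^bsub>G\<^esub> b" V1 "\<one>\<^bsub>G\<^esub>",
        OF topological_group_continuous_mult[OF G fs(1) topological_group_continuous_inv[OF G fs(2)]] V1(1)]
      V1(2) tsG by auto
  obtain U2 where U2: "openin T U2" "\<one>\<^bsub>G\<^esub> \<in> U2"
    "\<And>a b. a \<in> U2 \<Longrightarrow> b \<in> U2 \<Longrightarrow> inv\<^bsub>G\<^esub> a \<otimes>\<^bsub>G\<^esub> b \<in> V1"
    using continuous_binary_nbhd[of T T "\<lambda>a b. inv\<^bsub>G\<^esub> a \<otimes>\<^bsub>G\<^esub> b" V1 "\<one>\<^bsub>G\<^esub>",
        OF topological_group_continuous_mult[OF G topological_group_continuous_inv[OF G fs(1)] fs(2)] V1(1)]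
      V1(2) tsG by auto
  define U where "U = U1 \<inter> U2"
  have U: "openin T U" "\<one>\<^bsub>G\<^esub> \<in> U" using U1 U2 by (auto simp: U_def)
  have UG: "U \<subseteq> carrier G" and V1G: "V1 \<subseteq> carrier G"
    using openin_subset[OF U(1)] openin_subset[OF V1(1)] tsG by auto
  obtain F where F: "finite F" "F \<subseteq> carrier G" "set_prod3 G U F U = carrier G"
    using RP U unfolding Roelcke_precompact_def by blast
  define C where "C = S closure_of (\<phi> ` U)"
  have CB: "C \<subseteq> carrier B" using closure_of_subset_topspace[of S "\<phi> ` U"] tsB by (simp add: C_def)
  have \<phi>UC: "\<phi> ` U \<subseteq> C" unfolding C_def using UG tsB by (intro closure_of_subset) auto
  define D where "D f = (\<lambda>p. fst p \<otimes>\<^bsub>B\<^esub> \<phi> f \<otimes>\<^bsub>B\<^esub> snd p) ` (C \<times> C)" for f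
  have Dclosed: "closedin S (D f)" if "f \<in> F" for f
  proof -
    \<comment> \<open>Taking the closure before multiplying makes \<open>C\<close> compact, so
      \<open>D f\<close>, a continuous image of \<open>C \<times> C\<close>, is closed in the
      Hausdorff group \<open>B\<close>.\<close>
    have cC: "compactin S C" unfolding C_def using cS by (intro closedin_compact_space) auto
    have "continuous_map (prod_topology S S) S (\<lambda>p. fst p \<otimes>\<^bsub>B\<^esub> \<phi> f \<otimes>\<^bsub>B\<^esub> snd p)"
      using that F(2) tsB
      by (intro topological_group_continuous_mult[OF TB] fs) auto
    moreover have "compactin (prod_topology S S) (C \<times> C)"
      using cC by (simp add: compactin_Times)
    ultimately show ?thesis
      unfolding D_def by (intro compactin_imp_closedin[OF hS] image_compactin)
  qed
  have cover: "carrier B \<subseteq> (\<Union>f\<in>F. D f)"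
  proof -
    have "\<phi> ` carrier G \<subseteq> (\<Union>f\<in>F. D f)"
    proof
      fix z assume "z \<in> \<phi> ` carrier G"
      then obtain g where "g \<in> set_prod3 G U F U" "z = \<phi> g" using F(3) by auto
      then obtain u f v where z: "z = \<phi> (u \<otimes>\<^bsub>G\<^esub> f \<otimes>\<^bsub>G\<^esub> v)" "u \<in> U" "f \<in> F" "v \<in> U"
        unfolding set_prod3_def by blast
      then have "z = \<phi> u \<otimes>\<^bsub>B\<^esub> \<phi> f \<otimes>\<^bsub>B\<^esub> \<phi> v"
        using UG F(2) by (simp add: subset_iff)
      then have "z \<in> D f" unfolding D_def using z \<phi>UC by (intro image_eqI[of _ _ "(\<phi> u, \<phi> v)"]) auto
      with z show "z \<in> (\<Union>f\<in>F. D f)" by blast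
    qed
    \<comment> \<open>A closed set containing the dense image of \<open>\<phi>\<close> is all of
      \<open>B\<close>.\<close>
    moreover have "closedin S (\<Union>f\<in>F. D f)"
      using F(1) Dclosed by (intro closedin_Union) auto
    ultimately show ?thesis using dense closure_of_minimal by blast
  qed
  \<comment> \<open>On \<open>\<phi>(U)\<close> the quotient is computed in \<open>G\<close>;
    continuity extends the result to \<open>C\<close>.\<close>
  have cl1: "a \<otimes>\<^bsub>B\<^esub> inv\<^bsub>B\<^esub> b \<in> S closure_of (\<phi> ` V1)" if "a \<in> C" "b \<in> C" for a b
  proof (rule continuous_binary_closure[of S S S "\<lambda>a b. a \<otimes>\<^bsub>B\<^esub> inv\<^bsub>B\<^esub> b"])
    show "continuous_map (prod_topology S S) S (\<lambda>p. fst p \<otimes>\<^bsub>B\<^esub> inv\<^bsub>B\<^esub> snd p)"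
      by (intro topological_group_continuous_mult[OF TB] topological_group_continuous_inv[OF TB] fs)
    show "a \<in> S closure_of (\<phi> ` U)" "b \<in> S closure_of (\<phi> ` U)" using that by (auto simp: C_def)
    show "x \<otimes>\<^bsub>B\<^esub> inv\<^bsub>B\<^esub> y \<in> \<phi> ` V1" if xy: "x \<in> \<phi> ` U" "y \<in> \<phi> ` U" for x y
    proof -
      obtain u v where uv: "u \<in> U" "v \<in> U" "x = \<phi> u" "y = \<phi> v" using xy by blast
      then have "x \<otimes>\<^bsub>B\<^esub> inv\<^bsub>B\<^esub> y = \<phi> (u \<otimes>\<^bsub>G\<^esub> inv\<^bsub>G\<^esub> v)" using UG by (auto simp: subset_iff)
      with uv U1(3)[of u v] show ?thesis by (auto simp: U_def)
    qed
  qed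
  have cl2: "inv\<^bsub>B\<^esub> a \<otimes>\<^bsub>B\<^esub> b \<in> S closure_of (\<phi> ` V1)" if "a \<in> C" "b \<in> C" for a b
  proof (rule continuous_binary_closure[of S S S "\<lambda>a b. inv\<^bsub>B\<^esub> a \<otimes>\<^bsub>B\<^esub> b"])
    show "continuous_map (prod_topology S S) S (\<lambda>p. inv\<^bsub>B\<^esub> fst p \<otimes>\<^bsub>B\<^esub> snd p)"
      by (intro topological_group_continuous_mult[OF TB] topological_group_continuous_inv[OF TB] fs)
    show "a \<in> S closure_of (\<phi> ` U)" "b \<in> S closure_of (\<phi> ` U)" using that by (auto simp: C_def)
    show "inv\<^bsub>B\<^esub> x \<otimes>\<^bsub>B\<^esub> y \<in> \<phi> ` V1" if xy: "x \<in> \<phi> ` U" "y \<in> \<phi> ` U" for x y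
    proof -
      obtain u v where uv: "u \<in> U" "v \<in> U" "x = \<phi> u" "y = \<phi> v" using xy by blast
      then have "inv\<^bsub>B\<^esub> x \<otimes>\<^bsub>B\<^esub> y = \<phi> (inv\<^bsub>G\<^esub> u \<otimes>\<^bsub>G\<^esub> v)" using UG by (auto simp: subset_iff)
      with uv U2(3)[of u v] show ?thesis by (auto simp: U_def)
    qed
  qed
  have cl3: "a \<otimes>\<^bsub>B\<^esub> b \<in> S closure_of (\<phi> ` V)"
    if "a \<in> S closure_of (\<phi> ` V1)" "b \<in> S closure_of (\<phi> ` V1)" for a b
  proof (rule continuous_binary_closure[of S S S "\<lambda>a b. a \<otimes>\<^bsub>B\<^esub> b", OF _ that])
    show "continuous_map (prod_topology S S) S (\<lambda>p. fst p \<otimes>\<^bsub>B\<^esub> snd p)"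
      by (intro topological_group_continuous_mult[OF TB] fs)
    show "x \<otimes>\<^bsub>B\<^esub> y \<in> \<phi> ` V" if xy: "x \<in> \<phi> ` V1" "y \<in> \<phi> ` V1" for x y
    proof -
      obtain u v where uv: "u \<in> V1" "v \<in> V1" "x = \<phi> u" "y = \<phi> v" using xy by blast
      then have "x \<otimes>\<^bsub>B\<^esub> y = \<phi> (u \<otimes>\<^bsub>G\<^esub> v)" using V1G by (auto simp: subset_iff)
      with uv V1(3)[of u v] show ?thesis by auto
    qed
  qed
  \<comment> \<open>If \<open>1 = a f b\<close> then \<open>a' f b' = (a' a\<^sup>-\<^sup>1) (b\<^sup>-\<^sup>1 b')\<close>.\<close>
  have D_sub: "D f \<subseteq> S closure_of (\<phi> ` V)" if f: "f \<in> F" and one: "\<one>\<^bsub>B\<^esub> \<in> D f" for f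
  proof
    fix z assume "z \<in> D f"
    then obtain a' b' where z: "a' \<in> C" "b' \<in> C" "z = a' \<otimes>\<^bsub>B\<^esub> \<phi> f \<otimes>\<^bsub>B\<^esub> b'"
      unfolding D_def by auto
    obtain a b where ab: "a \<in> C" "b \<in> C" "\<one>\<^bsub>B\<^esub> = a \<otimes>\<^bsub>B\<^esub> \<phi> f \<otimes>\<^bsub>B\<^esub> b"
      using one unfolding D_def by auto
    have c: "a \<in> carrier B" "b \<in> carrier B" "a' \<in> carrier B" "b' \<in> carrier B" "\<phi> f \<in> carrier B"
      using z ab CB f F(2) by auto
    have "\<phi> f = inv\<^bsub>B\<^esub> a \<otimes>\<^bsub>B\<^esub> (a \<otimes>\<^bsub>B\<^esub> \<phi> f \<otimes>\<^bsub>B\<^esub> b) \<otimes>\<^bsub>B\<^esub> inv\<^bsub>B\<^esub> b"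
      using c by (simp add: H.m_assoc H.inv_solve_left)
    then have "\<phi> f = inv\<^bsub>B\<^esub> a \<otimes>\<^bsub>B\<^esub> inv\<^bsub>B\<^esub> b"
      using ab(3)[symmetric] c by simp
    then have "z = (a' \<otimes>\<^bsub>B\<^esub> inv\<^bsub>B\<^esub> a) \<otimes>\<^bsub>B\<^esub> (inv\<^bsub>B\<^esub> b \<otimes>\<^bsub>B\<^esub> b')"
      using z(3) c by (simp add: H.m_assoc)
    then show "z \<in> S closure_of (\<phi> ` V)"
      using cl3[OF cl1[OF z(1) ab(1)] cl2[OF ab(2) z(2)]] by simp
  qed
  \<comment> \<open>By \<open>cover\<close>, a point of \<open>W\<close> lies in some piece, and
    that piece contains the identity, so \<open>D_sub\<close> applies.\<close>
  define W where "W = carrier B - (\<Union>f\<in>{f\<in>F. \<one>\<^bsub>B\<^esub> \<notin> D f}. D f)"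
  show ?thesis
  proof (rule that)
    have "closedin S (\<Union>f\<in>{f\<in>F. \<one>\<^bsub>B\<^esub> \<notin> D f}. D f)"
      using F(1) Dclosed by (intro closedin_Union) auto
    then show "openin S W" unfolding W_def tsB[symmetric] by blast
    show "\<one>\<^bsub>B\<^esub> \<in> W" by (auto simp: W_def)
    show "W \<subseteq> S closure_of (\<phi> ` V)" using cover D_sub unfolding W_def by blast
  qed
qed

text \<open>Left translation by \<open>g\<close> and by \<open>\<phi> g\<close> moves the statement
  from the identity to an arbitrary point of the open set.\<close>

lemma Roelcke_precompact_nearly_open:
  assumes G: "topological_group G T" and RP: "Roelcke_precompact G T" and B: "compact_group B S"
    and \<phi>: "cont_hom G T B S \<phi>" and dense: "S closure_of (\<phi> ` carrier G) = carrier B"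
  shows "nearly_open_map T S \<phi>"
  unfolding nearly_open_map_def
proof (intro allI impI subsetI)
  fix U z assume U: "openin T U" and "z \<in> \<phi> ` U"
  then obtain g where g: "g \<in> U" "z = \<phi> g" by blast
  have TB: "topological_group B S" using B by (simp add: compact_group_def)
  have gG: "group G" and tsG: "topspace T = carrier G" using G by (auto simp: topological_group_def)
  have gB: "group B" and tsB: "topspace S = carrier B" using TB by (auto simp: topological_group_def)
  interpret group_hom G B \<phi>
    using gG gB \<phi> by (simp add: group_hom_def group_hom_axioms_def cont_hom_def)
  have UG: "U \<subseteq> carrier G" using openin_subset[OF U] tsG by simp
  then have gc: "g \<in> carrier G" using g by blast
  define V where "V = {x \<in> topspace T. g \<otimes>\<^bsub>G\<^esub> x \<in> U}"
  have hg: "homeomorphic_map T T (\<lambda>x. g \<otimes>\<^bsub>G\<^esub> x)"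
    by (rule topological_group_homeomorphic_translation[OF G gc])
  have hb: "homeomorphic_map S S (\<lambda>x. \<phi> g \<otimes>\<^bsub>B\<^esub> x)"
    using gc by (intro topological_group_homeomorphic_translation[OF TB]) simp
  have "openin T V"
    unfolding V_def by (rule openin_continuous_map_preimage[OF homeomorphic_imp_continuous_map[OF hg] U])
  moreover have "\<one>\<^bsub>G\<^esub> \<in> V" using g gc tsG by (simp add: V_def)
  ultimately obtain W where W: "openin S W" "\<one>\<^bsub>B\<^esub> \<in> W" "W \<subseteq> S closure_of (\<phi> ` V)"
    using Roelcke_precompact_closure_nbhd[OF G RP B \<phi> dense] by blast
  let ?W = "(\<lambda>x. \<phi> g \<otimes>\<^bsub>B\<^esub> x) ` W"
  have "openin S ?W"
    using homeomorphic_imp_open_map[OF hb] W(1) by (simp add: open_map_def)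
  moreover have "?W \<subseteq> S closure_of (\<phi> ` U)"
  proof -
    have "?W \<subseteq> S closure_of ((\<lambda>x. \<phi> g \<otimes>\<^bsub>B\<^esub> x) ` \<phi> ` V)"
      using continuous_map_image_closure_subset[OF homeomorphic_imp_continuous_map[OF hb]] W(3) by blast
    moreover have "(\<lambda>x. \<phi> g \<otimes>\<^bsub>B\<^esub> x) ` \<phi> ` V \<subseteq> \<phi> ` U"
    proof
      fix y assume "y \<in> (\<lambda>x. \<phi> g \<otimes>\<^bsub>B\<^esub> x) ` \<phi> ` V"
      then obtain v where v: "v \<in> V" "y = \<phi> g \<otimes>\<^bsub>B\<^esub> \<phi> v" by blast
      then have "y = \<phi> (g \<otimes>\<^bsub>G\<^esub> v)" using gc tsG by (simp add: V_def)
      then show "y \<in> \<phi> ` U" using v by (auto simp: V_def)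
    qed
    ultimately show ?thesis using closure_of_mono by blast
  qed
  moreover have "z \<in> ?W" using W(2) g gc by (intro image_eqI[of _ _ "\<one>\<^bsub>B\<^esub>"]) auto
  ultimately show "z \<in> S interior_of (S closure_of (\<phi> ` U))"
    using interior_of_maximal by blast
qed

section \<open>Surjectivity, by comparing \<open>\<phi>\<close> with its translates\<close>

theorem theorem5p5:
  fixes G :: "'a monoid" and T :: "'a topology"
    and B :: "'b monoid" and S :: "'b topology" and \<phi> :: "'a \<Rightarrow> 'b"
  assumes "Polish_group G T"
    and "Roelcke_precompact G T"
    and "Bohr_compactification_wrt G T \<phi> B S TYPE(('a + 'b) set set)"
  shows "\<phi> ` carrier G = carrier B"
proof -
  have G: "topological_group G T" and cm: "completely_metrizable_space T"
    using assms(1) by (auto simp: Polish_group_def Polish_space_def)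
  have B: "compact_group B S" and \<phi>: "cont_hom G T B S \<phi>"
    using assms(3) by (auto simp: Bohr_compactification_wrt_def)
  have TB: "topological_group B S" and hS: "Hausdorff_space S" using B by (auto simp: compact_group_def)
  have gG: "group G" and tsG: "topspace T = carrier G" using G by (auto simp: topological_group_def)
  have gB: "group B" and tsB: "topspace S = carrier B" using TB by (auto simp: topological_group_def)
  interpret group_hom G B \<phi>
    using gG gB \<phi> by (simp add: group_hom_def group_hom_axioms_def cont_hom_def)
  \<comment> \<open>Double singletons embed \<open>'b\<close> into the type over which the universal
    property ranges.\<close>
  have "inj (\<lambda>x :: 'b. {{Inr x :: 'a + 'b}})" by (auto simp: inj_def)
  then have dense: "S closure_of (\<phi> ` carrier G) = carrier B"
    using Bohr_compactification_dense[OF G assms(3)] by blast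
  have cont: "continuous_map T S \<phi>" using \<phi> by (simp add: cont_hom_def)
  have no: "nearly_open_map T S \<phi>"
    by (rule Roelcke_precompact_nearly_open[OF G assms(2) B \<phi> dense])
  have "k \<in> \<phi> ` carrier G" if k: "k \<in> carrier B" for k
  proof -
    have hk: "homeomorphic_map S S (\<lambda>x. k \<otimes>\<^bsub>B\<^esub> x)"
      by (rule topological_group_homeomorphic_translation[OF TB k])
    have "continuous_map T S (\<lambda>x. k \<otimes>\<^bsub>B\<^esub> \<phi> x)"
      using continuous_map_compose[OF cont homeomorphic_imp_continuous_map[OF hk]] by (simp add: o_def)
    \<comment> \<open>\<open>\<phi>\<close> and its left translate by \<open>k\<close> are
      continuous and nearly open, and \<open>\<phi>\<close> has dense image, so they share a value;
      solving for \<open>k\<close> exhibits it in the image.\<close>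
    then obtain x y where xy: "x \<in> carrier G" "y \<in> carrier G" "\<phi> x = k \<otimes>\<^bsub>B\<^esub> \<phi> y"
      using nearly_open_maps_images_meet[OF cm cm hS cont no _
          nearly_open_map_compose_homeomorphic[OF no cont hk]] dense tsG tsB by auto
    then have "k = \<phi> (x \<otimes>\<^bsub>G\<^esub> inv\<^bsub>G\<^esub> y)"
      using k by (simp add: H.inv_solve_right)
    with xy show ?thesis by blast
  qed
  then show ?thesis by auto
qed

end
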